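(* Let $b_1>1$ and $c>0$, let $M$ be the wave manifold with its coordinates $(t,z,Y)$ on $M\setminus\Pi$, and let $\mathcal C$ be its characteristic surface. In the coordinates $(t,z,Y)$ the fold curve is given by $Y=0$ and $t=0$. Moreover, the slow component $\mathcal C_s$ of $\mathcal C=\{Y=0\}$ is given by $t<0$ and the fast component $\mathcal C_f$ is given by $t>0$.
   Context: Setting. Let $F=(f,g):\mathbb R^2\to\mathbb R^2$ with $f(u,v)=\frac{v^2}{2}+(b_1+1)\frac{u^2}{2}+a_1u+a_2v$ and $g(u,v)=uv+a_3u+a_4v$, where $a_1,\dots,a_4$ are real constants, $b_1>1$ and $c:=a_3-a_2>0$. For $W=(u,v)$, $W'=(u',v')$ put $U=\frac{u+u'}2$, $V=\frac{v+v'}2$, $X=u-u'$, $Y=v-v'$, $\tilde U=b_1U+a_1-a_4$, $\tilde V=V+a_2$, $V_1=V+a_3=\tilde V+c$. Wave manifold. $M$ is the 3-manifold obtained by blowing up $\{(W,W',s): F(W)-F(W')=s(W-W')\}$ along the diagonal $W=W'$: it is the set of $(U,V,X,Y)$ together with a direction $Z\in\mathbb{RP}^1$ such that $Y=ZX$ and $(1-Z^2)\tilde V-Z\tilde U+c=0$ (suitably homogenized at $Z=\infty$). $\Pi\subset M$ is the plane $Z=0$. On $M\setminus\Pi$ put $z=1/Z$, so $X=zY$ and the equation of $M$ becomes $(z^2-1)V_1-z\tilde U+c=0$. Global coordinates $(t,z,Y)\in\mathbb R^3$ on $M\setminus\Pi$ are given by $$\tilde U=\frac{2cz}{z^2+1}+ct(z^2-1),\qquad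 V_1=\frac{c}{z^2+1}+ctz .$$ The (shock) speed is the function $s$ on $M$ extending the common value of $s$ in $F(W)-F(W')=s(W-W')$; on $M\setminus\Pi$ it is $s=U+a_4+zV_1$. A Hugoniot curve is a set $\{u=\text{const},\,v=\text{const}\}$ in $M$, equivalently $2\tilde U+b_1X=k$, $2\tilde V+Y=l$ for constants $k,l$. The characteristic surface is $\mathcal C=\{X=Y=0\}\subset M$, i.e. $Y=0$ in coordinates $(t,z,Y)$. A Hugoniot curve either meets $\mathcal C$ in two points, or meets it in exactly one point (tangency), or does not meet it. The fold curve (coincidence curve) is the set of points $p\in\mathcal C$ such that the Hugoniot curve through $p$ meets $\mathcal C$ only at $p$ (tangentially). If a Hugoniot curve meets $\mathcal C$ in two distinct points, the one with the smaller value of $s$ belongs by definition to the slow component $\mathcal C_s$, and the one with the larger value of $s$ belongs to the fast component $\mathcal C_f$; equivalently $\mathcal C_s$ and $\mathcal C_f$ correspond to the smaller and larger eigenvalue of $DF$. *)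

theory Defs
  imports "HOL-Analysis.Analysis"
begin

record quad_coeffs =
  a1 :: real
  a2 :: real
  a3 :: real
  a4 :: real
  b1 :: real

definition c_of :: "quad_coeffs \<Rightarrow> real" where
  "c_of P = a3 P - a2 P"

definition flux :: "quad_coeffs \<Rightarrow> real \<times> real \<Rightarrow> real \<times> real" where
  "flux P = (\<lambda>(u, v).
     (v\<^sup>2 / 2 + (b1 P + 1) * (u\<^sup>2 / 2) + a1 P * u + a2 P * v,
      u * v + a3 P * u + a4 P * v))"

text \<open>
  A point carries the means \<open>U, V\<close> and the differences \<open>X, Y\<close> of the two states, together
  with a direction. A direction, i.e. an element of the real projective line, is represented by
  a one-dimensional subspace of the plane; the line spanned by \<open>(x, y)\<close> stands for
  \<open>Z = y / x\<close>, and \<open>Z = \<infinity>\<close> is the line spanned by \<open>(0, 1)\<close>.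
\<close>

datatype wave_point =
  WP (U_of: real) (V_of: real) (X_of: real) (Y_of: real) (dir: "(real \<times> real) set")

definition direction :: "(real \<times> real) set \<Rightarrow> bool" where
  "direction L \<longleftrightarrow> subspace L \<and> dim L = 1"

definition u_of :: "wave_point \<Rightarrow> real" where
  "u_of p = U_of p + X_of p / 2"

definition v_of :: "wave_point \<Rightarrow> real" where
  "v_of p = V_of p + Y_of p / 2"

definition u'_of :: "wave_point \<Rightarrow> real" where
  "u'_of p = U_of p - X_of p / 2"

definition v'_of :: "wave_point \<Rightarrow> real" where
  "v'_of p = V_of p - Y_of p / 2"

definition Ut_of :: "quad_coeffs \<Rightarrow> wave_point \<Rightarrow> real" where
  "Ut_of P p = b1 P * U_of p + a1 P - a4 P"

definition Vt_of :: "quad_coeffs \<Rightarrow> wave_point \<Rightarrow> real" where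
  "Vt_of P p = V_of p + a2 P"

definition V1_of :: "quad_coeffs \<Rightarrow> wave_point \<Rightarrow> real" where
  "V1_of P p = V_of p + a3 P"

text \<open>
  \<open>(X, Y) \<in> L\<close> is \<open>Y = Z X\<close>, and the quadratic form is
  \<open>(1 - Z\<^sup>2) Vt - Z Ut + c\<close> multiplied by \<open>x\<^sup>2\<close>, which makes sense at \<open>Z = \<infinity>\<close> too.
\<close>

definition wave_manifold :: "quad_coeffs \<Rightarrow> wave_point set" where
  "wave_manifold P = {p. direction (dir p) \<and> (X_of p, Y_of p) \<in> dir p \<and>
     (\<forall>(x, y) \<in> dir p.
        (x\<^sup>2 - y\<^sup>2) * Vt_of P p - x * y * Ut_of P p + c_of P * x\<^sup>2 = 0)}"

definition plane_Pi :: "quad_coeffs \<Rightarrow> wave_point set" where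
  "plane_Pi P = {p \<in> wave_manifold P. dir p = span {(1, 0)}}"

text \<open>The inverse slope \<open>z = 1 / Z\<close>; only meaningful off the plane \<open>Z = 0\<close>.\<close>

definition z_of :: "wave_point \<Rightarrow> real" where
  "z_of p = (THE z. (z, 1) \<in> dir p)"

text \<open>
  The second component of \<open>F(W) - F(W') = s (W - W')\<close>, divided by \<open>Y\<close>, gives the formula off
  the plane \<open>Z = 0\<close>; the first one, divided by \<open>X\<close>, gives
  \<open>s = (b1 + 1) U + a1 + Z Vt\<close> wherever \<open>Z\<close> is finite, hence the value at \<open>Z = 0\<close>. The
  lemmas \<open>speed_secant\<close>, \<open>speed_coords\<close> and \<open>speed_finite_slope\<close> below show that this is
  the extension of \<open>s\<close> to the whole manifold.
\<close>

definition speed :: "quad_coeffs \<Rightarrow> wave_point \<Rightarrow> real" where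
  "speed P p =
     (if p \<in> plane_Pi P then (b1 P + 1) * U_of p + a1 P
      else U_of p + a4 P + z_of p * V1_of P p)"

text \<open>
  The point with coordinates \<open>(t, z, Y)\<close>: the first two entries solve
  \<open>Ut = 2 c z / (z\<^sup>2 + 1) + c t (z\<^sup>2 - 1)\<close> and \<open>V1 = c / (z\<^sup>2 + 1) + c t z\<close> for \<open>U\<close> and \<open>V\<close>.
  These coordinates cover exactly the complement of \<open>plane_Pi\<close>. The surface and curves defined
  below do meet that plane, e.g. the fold curve at \<open>Ut = V1 = 0\<close>.
\<close>

definition coords :: "quad_coeffs \<Rightarrow> real \<times> real \<times> real \<Rightarrow> wave_point" where
  "coords P = (\<lambda>(t, z, Y).
     WP ((2 * c_of P * z / (z\<^sup>2 + 1) + c_of P * t * (z\<^sup>2 - 1) - a1 P + a4 P) / b1 P)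
        (c_of P / (z\<^sup>2 + 1) + c_of P * t * z - a3 P)
        (z * Y) Y (span {(z, 1)}))"

definition char_surface :: "quad_coeffs \<Rightarrow> wave_point set" where
  "char_surface P = {p \<in> wave_manifold P. X_of p = 0 \<and> Y_of p = 0}"

definition hugoniot :: "quad_coeffs \<Rightarrow> real \<Rightarrow> real \<Rightarrow> wave_point set" where
  "hugoniot P u v = {p \<in> wave_manifold P. u_of p = u \<and> v_of p = v}"

definition fold_curve :: "quad_coeffs \<Rightarrow> wave_point set" where
  "fold_curve P = {p \<in> char_surface P.
     hugoniot P (u_of p) (v_of p) \<inter> char_surface P = {p}}"

definition slow_component :: "quad_coeffs \<Rightarrow> wave_point set" where
  "slow_component P = {p. \<exists>q u v. p \<noteq> q \<and>
     hugoniot P u v \<inter> char_surface P = {p, q} \<and> speed P p < speed P q}"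

definition fast_component :: "quad_coeffs \<Rightarrow> wave_point set" where
  "fast_component P = {p. \<exists>q u v. p \<noteq> q \<and>
     hugoniot P u v \<inter> char_surface P = {p, q} \<and> speed P q < speed P p}"


lemma direction_span: "d \<noteq> 0 \<Longrightarrow> direction (span {d})"
  by (simp add: direction_def dim_span dim_insert)

lemma direction_eq_span:
  assumes "direction L" "d \<in> L" "d \<noteq> 0"
  shows "L = span {d}"
proof -
  have L: "subspace L" "dim L = 1" using assms(1) by (auto simp: direction_def)
  have "span {d} \<subseteq> L" using L assms(2) by (simp add: span_minimal)
  moreover have "dim (span {d}) = 1" using assms(3) by (simp add: dim_span dim_insert)
  ultimately show ?thesis using L subspace_dim_equal[of "span {d}" L] by simp
qed

lemma mem_line: "(x, y) \<in> span {(a, b)} \<longleftrightarrow> (\<exists>k. x = k * a \<and> y = k * (b::real))"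
  by (auto simp: span_singleton)

lemma direction_cases:
  assumes "direction L"
  obtains "L = span {(1, 0)}" | z where "L = span {(z, 1)}"
proof -
  have s: "subspace L" using assms by (simp add: direction_def)
  have "\<not> L \<subseteq> {0}"
  proof
    assume "L \<subseteq> {0}"
    then have "dim L = 0" by (simp add: dim_eq_0)
    with assms show False by (simp add: direction_def)
  qed
  then obtain x y where xy: "(x, y) \<in> L" "(x, y) \<noteq> 0" by force
  show thesis
  proof (cases "y = 0")
    case True
    then have "(1, 0) \<in> L" using subspace_scale[OF s xy(1), of "1 / x"] xy(2) by (auto simp: zero_prod_def)
    then have "L = span {(1, 0)}"
      by (rule direction_eq_span[OF assms]) (simp add: zero_prod_def)
    then show thesis by (rule that(1))
  next
    case False
    then have "(x / y, 1) \<in> L" using subspace_scale[OF s xy(1), of "1 / y"] by simp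
    then have "L = span {(x / y, 1)}"
      by (rule direction_eq_span[OF assms]) (simp add: zero_prod_def)
    then show thesis by (rule that(2))
  qed
qed

lemma lines_distinct: "span {(z, 1)} \<noteq> span {(1::real, 0::real)}"
proof
  assume "span {(z, 1)} = span {(1::real, 0::real)}"
  moreover have "(z, 1) \<in> span {(z, 1::real)}" by (simp add: span_base)
  ultimately have "(z, 1) \<in> span {(1::real, 0::real)}" by simp
  then show False unfolding mem_line by simp
qed

lemma z_of_line: "dir p = span {(z, 1)} \<Longrightarrow> z_of p = z"
  by (auto simp: z_of_def mem_line)

lemma wave_manifold_z:
  assumes "dir p = span {(z, 1)}"
  shows "p \<in> wave_manifold P \<longleftrightarrow>
    X_of p = z * Y_of p \<and> (z\<^sup>2 - 1) * V1_of P p - z * Ut_of P p + c_of P = 0"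
proof -
  have *: "((k * z)\<^sup>2 - k\<^sup>2) * Vt_of P p - k * z * k * Ut_of P p + c_of P * (k * z)\<^sup>2
      = k\<^sup>2 * ((z\<^sup>2 - 1) * V1_of P p - z * Ut_of P p + c_of P)" for k
    by (simp add: V1_of_def Vt_of_def c_of_def) algebra
  have "(\<forall>(x, y) \<in> dir p.
        (x\<^sup>2 - y\<^sup>2) * Vt_of P p - x * y * Ut_of P p + c_of P * x\<^sup>2 = 0) \<longleftrightarrow>
      (\<forall>k. k\<^sup>2 * ((z\<^sup>2 - 1) * V1_of P p - z * Ut_of P p + c_of P) = 0)"
    unfolding assms *[symmetric] by (auto simp: mem_line)
  also have "\<dots> \<longleftrightarrow> (z\<^sup>2 - 1) * V1_of P p - z * Ut_of P p + c_of P = 0"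
    by (metis mult_1 mult_zero_right power_one)
  finally show ?thesis
    unfolding wave_manifold_def using direction_span[of "(z, 1)"] assms
    by (auto simp: mem_line zero_prod_def)
qed

lemma wave_manifold_Z:
  assumes "dir p = span {(1, Z)}"
  shows "p \<in> wave_manifold P \<longleftrightarrow>
    Y_of p = Z * X_of p \<and> (1 - Z\<^sup>2) * Vt_of P p - Z * Ut_of P p + c_of P = 0"
proof -
  have *: "(k\<^sup>2 - (k * Z)\<^sup>2) * Vt_of P p - k * (k * Z) * Ut_of P p + c_of P * k\<^sup>2
      = k\<^sup>2 * ((1 - Z\<^sup>2) * Vt_of P p - Z * Ut_of P p + c_of P)" for k
    by algebra
  have "(\<forall>(x, y) \<in> dir p.
        (x\<^sup>2 - y\<^sup>2) * Vt_of P p - x * y * Ut_of P p + c_of P * x\<^sup>2 = 0) \<longleftrightarrow>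
      (\<forall>k. k\<^sup>2 * ((1 - Z\<^sup>2) * Vt_of P p - Z * Ut_of P p + c_of P) = 0)"
    unfolding assms *[symmetric] by (auto simp: mem_line)
  also have "\<dots> \<longleftrightarrow> (1 - Z\<^sup>2) * Vt_of P p - Z * Ut_of P p + c_of P = 0"
    by (metis mult_1 mult_zero_right power_one)
  finally show ?thesis
    unfolding wave_manifold_def using direction_span[of "(1, Z)"] assms
    by (auto simp: mem_line zero_prod_def)
qed

lemma speed_secant:
  assumes "p \<in> wave_manifold P"
  shows "flux P (u_of p, v_of p) - flux P (u'_of p, v'_of p)
    = speed P p *\<^sub>R ((u_of p, v_of p) - (u'_of p, v'_of p))"
proof -
  have "direction (dir p)" using assms by (simp add: wave_manifold_def)
  then show ?thesis
  proof (cases rule: direction_cases)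
    case 1
    then have "p \<in> plane_Pi P" using assms by (simp add: plane_Pi_def)
    then have s: "speed P p = (b1 P + 1) * U_of p + a1 P" by (simp add: speed_def)
    have "Y_of p = 0" "V_of p = - a3 P"
      using wave_manifold_Z[OF 1, of P] assms by (auto simp: Vt_of_def c_of_def)
    then show ?thesis
      by (simp add: s flux_def u_of_def v_of_def u'_of_def v'_of_def power2_eq_square field_simps)
  next
    case (2 z)
    then have "p \<notin> plane_Pi P" using lines_distinct by (simp add: plane_Pi_def)
    then have s: "speed P p = U_of p + a4 P + z * V1_of P p"
      using z_of_line[OF 2] by (simp add: speed_def)
    have X: "X_of p = z * Y_of p"
      and e: "(z\<^sup>2 - 1) * V1_of P p - z * Ut_of P p + c_of P = 0"
      using wave_manifold_z[OF 2, of P] assms by auto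
    have "V_of p * Y_of p + (b1 P + 1) * U_of p * (z * Y_of p) + a1 P * (z * Y_of p)
        + a2 P * Y_of p = (U_of p + a4 P + z * V1_of P p) * (z * Y_of p)"
      using e unfolding V1_of_def Ut_of_def c_of_def by algebra
    then show ?thesis
      by (simp add: s X flux_def u_of_def v_of_def u'_of_def v'_of_def V1_of_def
          power2_eq_square field_simps)
  qed
qed

lemma speed_finite_slope:
  assumes "p \<in> wave_manifold P" "dir p = span {(1, Z)}"
  shows "speed P p = (b1 P + 1) * U_of p + a1 P + Z * Vt_of P p"
proof (cases "Z = 0")
  case True
  then show ?thesis using assms by (simp add: speed_def plane_Pi_def)
next
  case False
  have d: "dir p = span {(1 / Z, 1)}"
  proof -
    have "(1 / Z, 1) \<in> dir p" using False by (auto simp: assms(2) mem_line intro: exI[of _ "1 / Z"])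
    then show ?thesis using direction_eq_span assms(1) by (auto simp: wave_manifold_def zero_prod_def)
  qed
  then have s: "speed P p = U_of p + a4 P + (1 / Z) * V1_of P p"
    using lines_distinct z_of_line[OF d] by (simp add: speed_def plane_Pi_def)
  have "(1 - Z\<^sup>2) * Vt_of P p - Z * Ut_of P p + c_of P = 0"
    using wave_manifold_Z assms by blast
  then show ?thesis using False
    by (simp add: s V1_of_def Vt_of_def Ut_of_def c_of_def field_simps power2_eq_square)
qed

lemma coords_simps:
  assumes "b1 P \<noteq> 0"
  shows "Ut_of P (coords P (t, z, Y)) = 2 * c_of P * z / (z\<^sup>2 + 1) + c_of P * t * (z\<^sup>2 - 1)"
    and "V1_of P (coords P (t, z, Y)) = c_of P / (z\<^sup>2 + 1) + c_of P * t * z"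
    and "X_of (coords P (t, z, Y)) = z * Y"
    and "Y_of (coords P (t, z, Y)) = Y"
    and "dir (coords P (t, z, Y)) = span {(z, 1)}"
    and "z_of (coords P (t, z, Y)) = z"
  using assms by (auto simp: coords_def Ut_of_def V1_of_def z_of_line)

lemma bij_coords:
  assumes "b1 P > 1" "c_of P > 0"
  shows "bij_betw (coords P) UNIV (wave_manifold P - plane_Pi P)"
proof -
  have b: "b1 P \<noteq> 0" and c: "c_of P \<noteq> 0" using assms by auto
  have nz: "z\<^sup>2 + 1 \<noteq> 0" for z :: real
    by (metis add_nonneg_pos less_irrefl zero_le_power2 zero_less_one)
  show ?thesis
    unfolding bij_betw_def
  proof (intro conjI subset_antisym)
    show "inj (coords P)"
    proof (rule injI)
      fix w w'
      assume w: "coords P w = coords P w'"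
      obtain t z Y t' z' Y' where W: "w = (t, z, Y)" "w' = (t', z', Y')" by (metis prod_cases3)
      have e: "coords P (t, z, Y) = coords P (t', z', Y')" using w W by simp
      then have zY: "z' = z" "Y' = Y" using coords_simps(4,6)[OF b] by metis+
      have "c_of P * t * (z\<^sup>2 - 1) = c_of P * t' * (z\<^sup>2 - 1)" "c_of P * t * z = c_of P * t' * z"
        using coords_simps(1,2)[OF b, of t z Y] coords_simps(1,2)[OF b, of t' z Y]
        unfolding e zY by auto
      then show "w = w'" using c zY W by (cases "z = 0") auto
    qed
    show "range (coords P) \<subseteq> wave_manifold P - plane_Pi P"
    proof clarify
      fix t z Y
      let ?p = "coords P (t, z, Y)"
      have "(z\<^sup>2 - 1) * (c_of P / (z\<^sup>2 + 1)) - z * (2 * c_of P * z / (z\<^sup>2 + 1)) + c_of P = 0"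
        using nz[of z] by (simp add: divide_simps) algebra
      then have "(z\<^sup>2 - 1) * V1_of P ?p - z * Ut_of P ?p + c_of P = 0"
        unfolding coords_simps[OF b] by algebra
      then show "?p \<in> wave_manifold P - plane_Pi P"
        using wave_manifold_z[OF coords_simps(5)[OF b], of t z Y P] lines_distinct[of z]
        by (simp add: coords_simps[OF b] plane_Pi_def)
    qed
    show "wave_manifold P - plane_Pi P \<subseteq> range (coords P)"
    proof
      fix p assume p: "p \<in> wave_manifold P - plane_Pi P"
      then have "direction (dir p)" "dir p \<noteq> span {(1, 0)}"
        by (auto simp: wave_manifold_def plane_Pi_def)
      then obtain z where d: "dir p = span {(z, 1)}" by (metis direction_cases)
      have X: "X_of p = z * Y_of p"
        and e: "(z\<^sup>2 - 1) * V1_of P p - z * Ut_of P p + c_of P = 0"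
        using wave_manifold_z[OF d, of P] p by auto
      define A where "A = Ut_of P p - 2 * c_of P * z / (z\<^sup>2 + 1)"
      define B where "B = V1_of P p - c_of P / (z\<^sup>2 + 1)"
      have "(z\<^sup>2 - 1) * (c_of P / (z\<^sup>2 + 1)) - z * (2 * c_of P * z / (z\<^sup>2 + 1)) + c_of P = 0"
        using nz[of z] by (simp add: divide_simps) algebra
      then have AB: "(z\<^sup>2 - 1) * B = z * A"
        using e unfolding A_def B_def by algebra
      obtain t where t: "A = c_of P * t * (z\<^sup>2 - 1)" "B = c_of P * t * z"
      proof (cases "z = 0")
        case True
        then show thesis using AB c that[of "- A / c_of P"] by simp
      next
        case False
        then show thesis using AB c that[of "B / (c_of P * z)"] by (simp add: field_simps)
      qed
      have "p = coords P (t, z, Y_of p)"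
      proof (rule wave_point.expand, intro conjI)
        have "b1 P * U_of p + a1 P - a4 P = 2 * c_of P * z / (z\<^sup>2 + 1) + c_of P * t * (z\<^sup>2 - 1)"
          using t(1) by (simp add: A_def Ut_of_def)
        then show "U_of p = U_of (coords P (t, z, Y_of p))"
          using b by (simp add: coords_def eq_divide_eq mult.commute)
        show "V_of p = V_of (coords P (t, z, Y_of p))"
          using t(2) by (simp add: coords_def B_def V1_of_def)
      qed (simp_all add: X d coords_def)
      then show "p \<in> range (coords P)" by blast
    qed
  qed
qed

lemma speed_coords:
  assumes "b1 P > 1" "c_of P > 0"
  shows "speed P (coords P (t, z, Y)) =
    U_of (coords P (t, z, Y)) + a4 P + z * V1_of P (coords P (t, z, Y))"
  using assms lines_distinct[of z] by (simp add: speed_def plane_Pi_def coords_simps)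

lemma char_surface_coords:
  assumes "b1 P > 1" "c_of P > 0"
  shows "char_surface P - plane_Pi P = coords P ` {(t, z, Y). Y = 0}"
proof -
  have b: "b1 P \<noteq> 0" using assms by simp
  have "char_surface P - plane_Pi P
      = {p \<in> coords P ` UNIV. X_of p = 0 \<and> Y_of p = 0}"
    using bij_coords[OF assms] by (auto simp: bij_betw_def char_surface_def)
  also have "\<dots> = coords P ` {(t, z, Y). Y = 0}"
    by (auto simp: coords_simps[OF b] image_iff)
  finally show ?thesis .
qed

end

theory Submission
  imports Defs
begin

text \<open>
  At a state with \<open>U\<close>, \<open>V\<close> fixed the directions of the characteristic points are the zeros of the
  form \<open>V1 x\<^sup>2 - Ut x y - (V1 - c) y\<^sup>2\<close>. If \<open>(z, 1)\<close> is one of them, the form factors as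
  \<open>(x - z y) (V1 x - (Ut - z V1) y)\<close>, so the other one is spanned by \<open>(Ut - z V1, V1)\<close>. In the
  coordinates \<open>(t, z, Y)\<close> one has \<open>Ut - 2 z V1 = - c t (z\<^sup>2 + 1)\<close>. This number vanishes exactly
  when the two directions agree, and it is also the difference of the two speeds.
\<close>

lemma line_parallel_eq:
  fixes a b x y :: real
  assumes "(a, b) \<noteq> 0" "(x, y) \<noteq> 0" "a * y = b * x"
  shows "span {(a, b)} = span {(x, y)}"
proof -
  have "(x, y) \<in> span {(a, b)}"
  proof (cases "a = 0")
    case True
    then show ?thesis using assms
      by (auto simp: mem_line zero_prod_def intro!: exI[of _ "y / b"])
  next
    case False
    then show ?thesis using assms
      by (auto simp: mem_line field_simps intro!: exI[of _ "x / a"])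
  qed
  then show ?thesis
    using direction_eq_span[OF direction_span[OF assms(1)]] assms(2) by simp
qed

lemma wave_point_eq_iff:
  "p = q \<longleftrightarrow> U_of p = U_of q \<and> V_of p = V_of q \<and> X_of p = X_of q \<and> Y_of p = Y_of q \<and>
    dir p = dir q"
  by (cases p; cases q) simp

text \<open>The candidate for the second characteristic point over the same state. A spanning vector
  is used instead of an inverse slope because this point lies on the plane \<open>Z = 0\<close> when
  \<open>V1_of P p = 0\<close>, even if \<open>p\<close> does not.\<close>

definition opposite :: "quad_coeffs \<Rightarrow> wave_point \<Rightarrow> wave_point" where
  "opposite P p = WP (U_of p) (V_of p) 0 0
     (span {(Ut_of P p - z_of p * V1_of P p, V1_of P p)})"

context
  fixes P :: quad_coeffs and t z :: real and p :: wave_point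
  assumes b: "b1 P > 1" and c: "c_of P > 0"
  defines "p \<equiv> coords P (t, z, 0)"
begin

lemma char_point:
  "p \<in> char_surface P" "X_of p = 0" "Y_of p = 0" "dir p = span {(z, 1)}" "z_of p = z"
  "p \<notin> plane_Pi P"
proof -
  have "p \<in> coords P ` {(t, z, Y). Y = 0}" by (auto simp: p_def)
  then show "p \<in> char_surface P" "p \<notin> plane_Pi P"
    using char_surface_coords[OF b c] by auto
  show "X_of p = 0" "Y_of p = 0" "dir p = span {(z, 1)}" "z_of p = z"
    using b by (simp_all add: p_def coords_simps)
qed

lemma Ut_minus_twice: "Ut_of P p - 2 * z * V1_of P p = - (c_of P * t * (z\<^sup>2 + 1))"
proof -
  \<comment> \<open>Both formulas share the term \<open>c_of P / (z\<^sup>2 + 1)\<close>, which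
    cancels as an atom in the difference, so no denominator has to be cleared.\<close>
  have "Ut_of P p = 2 * z * (c_of P / (z\<^sup>2 + 1)) + c_of P * t * (z\<^sup>2 - 1)"
    "V1_of P p = c_of P / (z\<^sup>2 + 1) + c_of P * t * z"
    using b by (simp_all add: p_def coords_simps)
  then show ?thesis by algebra
qed

text \<open>If \<open>Ut\<close> and \<open>V1\<close> both vanished, the equation of the manifold
  at \<open>p\<close> would reduce to \<open>c_of P = 0\<close>.\<close>

lemma opposite_direction_nonzero: "(Ut_of P p - z * V1_of P p, V1_of P p) \<noteq> 0"
proof
  assume "(Ut_of P p - z * V1_of P p, V1_of P p) = 0"
  then have V: "V1_of P p = 0" and U: "Ut_of P p = 0" by (auto simp: zero_prod_def)
  have "(z\<^sup>2 - 1) * V1_of P p - z * Ut_of P p + c_of P = 0"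
    using wave_manifold_z[OF char_point(4)] char_point(1) by (auto simp: char_surface_def)
  then show False using U V c by simp
qed

text \<open>The coefficients of \<open>x\<^sup>2\<close> and \<open>x * y\<close> agree identically;
  equality of those of \<open>y\<^sup>2\<close> is the equation of the manifold at
  \<open>p\<close>.\<close>

lemma form_factor:
  "(x\<^sup>2 - y\<^sup>2) * Vt_of P p - x * y * Ut_of P p + c_of P * x\<^sup>2
    = (x - z * y) * (V1_of P p * x - (Ut_of P p - z * V1_of P p) * y)"
proof -
  have "(z\<^sup>2 - 1) * V1_of P p - z * Ut_of P p + c_of P = 0"
    using wave_manifold_z[OF char_point(4)] char_point(1) by (auto simp: char_surface_def)
  moreover have "Vt_of P p = V1_of P p - c_of P"
    by (simp add: Vt_of_def V1_of_def c_of_def)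
  ultimately show ?thesis by algebra
qed

lemma opposite_eq_iff: "opposite P p = p \<longleftrightarrow> t = 0"
proof -
  let ?w = "Ut_of P p - z * V1_of P p"
  have "opposite P p = p \<longleftrightarrow> span {(?w, V1_of P p)} = span {(z, 1)}"
    using char_point by (auto simp: opposite_def wave_point_eq_iff)
  also have "\<dots> \<longleftrightarrow> ?w = z * V1_of P p"
  proof
    assume "span {(?w, V1_of P p)} = span {(z, 1)}"
    then have "(?w, V1_of P p) \<in> span {(z, 1)}" by (metis insertI1 span_base)
    then show "?w = z * V1_of P p" by (auto simp: mem_line)
  next
    assume "?w = z * V1_of P p"
    then show "span {(?w, V1_of P p)} = span {(z, 1)}"
      using opposite_direction_nonzero
      by (intro line_parallel_eq) (auto simp: zero_prod_def)
  qed
  also have "\<dots> \<longleftrightarrow> c_of P * t * (z\<^sup>2 + 1) = 0" using Ut_minus_twice by auto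
  also have "\<dots> \<longleftrightarrow> t = 0"
    using c by (auto simp: add_nonneg_eq_0_iff)
  finally show ?thesis .
qed

text \<open>Since \<open>X = Y = 0\<close> on the characteristic surface, fixing \<open>u\<close>
  and \<open>v\<close> fixes \<open>U\<close> and \<open>V\<close>. Only the direction remains free,
  and it must be one of the two zero lines of the form at \<open>p\<close>.\<close>

lemma hugoniot_char_points:
  "hugoniot P (u_of p) (v_of p) \<inter> char_surface P = {p, opposite P p}"
proof (intro subset_antisym subsetI)
  let ?w = "Ut_of P p - z * V1_of P p"
  fix r assume r: "r \<in> hugoniot P (u_of p) (v_of p) \<inter> char_surface P"
  then have UV: "U_of r = U_of p" "V_of r = V_of p" "X_of r = 0" "Y_of r = 0"
    and d: "direction (dir r)"
    and f: "\<And>x y. (x, y) \<in> dir r \<Longrightarrow>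
      (x\<^sup>2 - y\<^sup>2) * Vt_of P r - x * y * Ut_of P r + c_of P * x\<^sup>2 = 0"
    using char_point
    by (auto simp: hugoniot_def char_surface_def wave_manifold_def u_of_def v_of_def)
  have same: "Vt_of P r = Vt_of P p" "Ut_of P r = Ut_of P p"
    using UV by (simp_all add: Vt_of_def Ut_of_def)
  \<comment> \<open>A nonzero spanning vector lets points \<open>r\<close> on and off the plane
    \<open>Z = 0\<close> be treated alike.\<close>
  obtain x y where xy: "dir r = span {(x, y)}" "(x, y) \<noteq> 0"
    using d
  proof (cases rule: direction_cases)
    case 1
    then show thesis by (intro that[of 1 0]) (auto simp: zero_prod_def)
  next
    case (2 z')
    then show thesis by (intro that[of z' 1]) (auto simp: zero_prod_def)
  qed
  have "(x, y) \<in> dir r" by (simp add: xy span_base)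
  then have "(x - z * y) * (V1_of P p * x - ?w * y) = 0"
    using f unfolding same form_factor by blast
  then consider "z * y = 1 * x" | "?w * y = V1_of P p * x" by auto
  then have "dir r = span {(z, 1)} \<or> dir r = span {(?w, V1_of P p)}"
  proof cases
    case 1
    then show ?thesis
      using line_parallel_eq[of z 1 x y] xy by (simp add: zero_prod_def)
  next
    case 2
    then show ?thesis
      using line_parallel_eq[OF opposite_direction_nonzero xy(2)] xy(1) by simp
  qed
  then show "r \<in> {p, opposite P p}"
    using UV char_point by (auto simp: opposite_def wave_point_eq_iff)
next
  let ?w = "Ut_of P p - z * V1_of P p"
  have "direction (span {(?w, V1_of P p)})"
    by (rule direction_span[OF opposite_direction_nonzero])
  \<comment> \<open>The factored form along the opposite line, at its general vector: the second
    factor vanishes.\<close>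
  moreover have "(k * ?w - z * (k * V1_of P p)) *
      (V1_of P p * (k * ?w) - ?w * (k * V1_of P p)) = 0" for k
    by (simp add: algebra_simps)
  moreover have "Vt_of P (opposite P p) = Vt_of P p" "Ut_of P (opposite P p) = Ut_of P p"
    by (simp_all add: opposite_def Vt_of_def Ut_of_def)
  ultimately have "opposite P p \<in> wave_manifold P"
    using char_point
    by (auto simp: wave_manifold_def form_factor)
      (auto simp: opposite_def mem_line span_zero)
  then have "opposite P p \<in> hugoniot P (u_of p) (v_of p) \<inter> char_surface P"
    using char_point
    by (auto simp: hugoniot_def char_surface_def u_of_def v_of_def opposite_def)
  moreover have "p \<in> hugoniot P (u_of p) (v_of p) \<inter> char_surface P"
    using char_point by (auto simp: hugoniot_def char_surface_def)
  ultimately show "r \<in> hugoniot P (u_of p) (v_of p) \<inter> char_surface P"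
    if "r \<in> {p, opposite P p}" for r
    using that by blast
qed

lemma speed_opposite:
  "speed P (opposite P p) - speed P p = - (c_of P * t * (z\<^sup>2 + 1))"
proof -
  let ?w = "Ut_of P p - z * V1_of P p"
  have s: "speed P p = U_of p + a4 P + z * V1_of P p"
    using char_point by (simp add: speed_def)
  have q: "opposite P p \<in> wave_manifold P" "dir (opposite P p) = span {(?w, V1_of P p)}"
    using hugoniot_char_points char_point by (auto simp: char_surface_def opposite_def)
  \<comment> \<open>Off the plane \<open>Z = 0\<close> the inverse slope is \<open>?w / V1\<close>,
    and multiplying it by \<open>V1\<close> leaves \<open>?w\<close>. On that plane
    \<open>V1 = 0\<close> and \<open>?w = Ut\<close>, and the other speed formula gives the same
    value because \<open>(b1 P + 1) * U + a1 P = U + a4 P + Ut\<close>.\<close>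
  have "speed P (opposite P p) = U_of p + a4 P + ?w"
  proof (cases "V1_of P p = 0")
    case True
    then have "dir (opposite P p) = span {(1, 0)}"
      using opposite_direction_nonzero unfolding q(2)
      by (intro line_parallel_eq) (auto simp: zero_prod_def)
    then have "opposite P p \<in> plane_Pi P" using q by (simp add: plane_Pi_def)
    then show ?thesis using True
      by (simp add: speed_def opposite_def Ut_of_def algebra_simps)
  next
    case False
    then have d: "dir (opposite P p) = span {(?w / V1_of P p, 1)}"
      using opposite_direction_nonzero unfolding q(2)
      by (intro line_parallel_eq) (auto simp: zero_prod_def)
    then have "opposite P p \<notin> plane_Pi P" using lines_distinct by (simp add: plane_Pi_def)
    moreover have "U_of (opposite P p) = U_of p" "V1_of P (opposite P p) = V1_of P p"
      by (simp_all add: opposite_def V1_of_def)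
    ultimately show ?thesis using False z_of_line[OF d] by (simp add: speed_def)
  qed
  then show ?thesis using s Ut_minus_twice by simp
qed

lemma speed_less_opposite_iff:
  "speed P p < speed P (opposite P p) \<longleftrightarrow> t < 0"
  "speed P (opposite P p) < speed P p \<longleftrightarrow> t > 0"
proof -
  define k where "k = c_of P * (z\<^sup>2 + 1)"
  have "k > 0" using c by (simp add: k_def add_nonneg_pos)
  then have "k * t < 0 \<longleftrightarrow> t < 0" "k * t > 0 \<longleftrightarrow> t > 0"
    by (simp_all add: mult_less_0_iff zero_less_mult_iff)
  moreover have "speed P (opposite P p) - speed P p = - (k * t)"
    using speed_opposite by (simp add: k_def mult.commute mult.left_commute)
  ultimately show "speed P p < speed P (opposite P p) \<longleftrightarrow> t < 0"
    "speed P (opposite P p) < speed P p \<longleftrightarrow> t > 0"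
    by linarith+
qed

text \<open>Eliminates the existential quantifiers from the definitions of the two components:
  \<open>p\<close> lies on the curve, which forces \<open>u\<close> and \<open>v\<close>, and then
  \<open>q\<close> has to be the other point.\<close>

lemma two_point_hugoniot_iff:
  "p \<noteq> q \<and> hugoniot P u v \<inter> char_surface P = {p, q} \<longleftrightarrow>
    t \<noteq> 0 \<and> q = opposite P p \<and> u = u_of p \<and> v = v_of p"
proof
  assume a: "p \<noteq> q \<and> hugoniot P u v \<inter> char_surface P = {p, q}"
  then have "p \<in> hugoniot P u v" by blast
  then have uv: "u = u_of p" "v = v_of p" by (auto simp: hugoniot_def)
  then have "{p, q} = {p, opposite P p}" using a hugoniot_char_points by simp
  then have "q = opposite P p" using a by (auto simp: doubleton_eq_iff)
  then show "t \<noteq> 0 \<and> q = opposite P p \<and> u = u_of p \<and> v = v_of p"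
    using uv a opposite_eq_iff by metis
next
  assume "t \<noteq> 0 \<and> q = opposite P p \<and> u = u_of p \<and> v = v_of p"
  then show "p \<noteq> q \<and> hugoniot P u v \<inter> char_surface P = {p, q}"
    using opposite_eq_iff hugoniot_char_points by metis
qed

lemma component_iff:
  "p \<in> fold_curve P \<longleftrightarrow> t = 0"
  "p \<in> slow_component P \<longleftrightarrow> t < 0"
  "p \<in> fast_component P \<longleftrightarrow> t > 0"
proof -
  have "p \<in> fold_curve P \<longleftrightarrow> {p, opposite P p} = {p}"
    using char_point(1) hugoniot_char_points by (simp add: fold_curve_def)
  then show "p \<in> fold_curve P \<longleftrightarrow> t = 0" using opposite_eq_iff by auto
  show "p \<in> slow_component P \<longleftrightarrow> t < 0"
    \<comment> \<open>Reassociating groups the first two conjuncts into the left side of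
      \<open>two_point_hugoniot_iff\<close>, leaving only the comparison of speeds.\<close>
    unfolding slow_component_def mem_Collect_eq conj_assoc[symmetric] two_point_hugoniot_iff
    using speed_less_opposite_iff(1) by auto
  show "p \<in> fast_component P \<longleftrightarrow> t > 0"
    unfolding fast_component_def mem_Collect_eq conj_assoc[symmetric] two_point_hugoniot_iff
    using speed_less_opposite_iff(2) by auto
qed

end

text \<open>Turns a pointwise criterion in \<open>t\<close> into an equality of sets, since every
  characteristic point off \<open>plane_Pi P\<close> has the form
  \<open>coords P (t, z, 0)\<close>.\<close>

lemma part_of_char_surface_coords:
  assumes "b1 P > 1" "c_of P > 0" "S \<subseteq> char_surface P"
    and "\<And>t z. coords P (t, z, 0) \<in> S \<longleftrightarrow> Q t"
  shows "S - plane_Pi P = coords P ` {(t, z, Y). Y = 0 \<and> Q t}"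
proof -
  have "S - plane_Pi P = S \<inter> coords P ` {(t, z, Y). Y = 0}"
    using char_surface_coords[OF assms(1,2)] assms(3) by blast
  also have "\<dots> = coords P ` {(t, z, Y). Y = 0 \<and> Q t}"
    using assms(4) by auto
  finally show ?thesis .
qed

theorem lemma1:
  fixes P :: quad_coeffs
  assumes "b1 P > 1" and "c_of P > 0"
  shows "fold_curve P - plane_Pi P = coords P ` {(t, z, Y). Y = 0 \<and> t = 0} \<and>
    slow_component P - plane_Pi P = coords P ` {(t, z, Y). Y = 0 \<and> t < 0} \<and>
    fast_component P - plane_Pi P = coords P ` {(t, z, Y). Y = 0 \<and> t > 0}"
proof (intro conjI part_of_char_surface_coords assms component_iff)
  show "fold_curve P \<subseteq> char_surface P" by (auto simp: fold_curve_def)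
  show "slow_component P \<subseteq> char_surface P" by (auto simp: slow_component_def)
  show "fast_component P \<subseteq> char_surface P" by (auto simp: fast_component_def)
qed

end
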